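(* Let $\delta\ge 0$, let $g^\delta\in H_2$ satisfy $\|g^\delta-g\|\le\delta$, and let $\{(u_n^\delta,p_n^\delta)\}_{n\ge 1}$ be generated by the augmented Lagrangian method with data $g^\delta$ and starting element $p_0^\delta\in H_2$. Assume that $u^\dagger$ is a $J$-minimizing solution of $Ku=g$ which satisfies the source condition $K^*p^\dagger\in\partial J(u^\dagger)$ with source element $p^\dagger\in H_2$. Then for any $\gamma>0$ and all $n\in\mathbb{N}$, $n\geq 1$, $$D^{u^\dagger}_{J^*}(K^*p_n^\delta,K^*p^\dagger)+\frac{t_n}{4}\|Ku_n^\delta-g\|^2+\frac{\gamma-1}{2\gamma t_n}\|p_n^\delta-p^\dagger\|^2\le\frac{\|p^\dagger-p_0^\delta\|^2}{2t_n}+\frac{(1+\gamma)t_n}{2}\delta^2 .$$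
   Context: $H_1,H_2$ are separable (real) Hilbert spaces, $K:H_1\to H_2$ is linear and bounded with adjoint $K^*$, and $J:H_1\to\mathbb{R}\cup\{\infty\}$ is convex, lower semicontinuous and proper with domain $D(J)=\{u: J(u)<\infty\}$. It is assumed that for every $c\in\mathbb{R}$ every sequence in $\{u\in H_1:\|Ku\|^2+J(u)\le c\}$ has a weakly convergent subsequence in $H_1$. The element $g\in H_2$ is attainable, i.e. $Ku=g$ for some $u\in D(J)$. A $J$-minimizing solution of $Ku=g$ is a minimizer of $J(u)$ subject to $Ku=g$. Augmented Lagrangian method: $\{\tau_n\}_{n\ge1}$ is a fixed sequence of positive numbers, $t_n:=\sum_{k=1}^n\tau_k$, with $t_n\to+\infty$ and $\bar\tau:=\sup_k\tau_k<\infty$. Given $p_0^\delta\in H_2$, for $n=1,2,\dots$ $$u_n^\delta\in\operatorname{argmin}_{u\in H_1}\Big(\tfrac{\tau_n}{2}\|Ku-g^\delta\|^2+J(u)-\langle p_{n-1}^\delta,Ku-g^\delta\rangle\Big),\qquad p_n^\delta=p_{n-1}^\delta+\tau_n(g^\delta-Ku_n^\delta).$$ $J^*(v)=\sup_{u\in H_1}(\langle v,u\rangle-J(u))$ is the Legendre-Fenchel conjugate; $K^*p^\dagger\in\partial J(u^\dagger)$ is equivalent to $u^\dagger\in\partial J^*(K^*p^\dagger)$. For a convex functional $F$ and $\xi\in\partial F(u)$ the Bregman distance is $D_F^\xi(v,u)=F(v)-F(u)-\langle\xi,v-u\rangle$; thus $D_{J^*}^{u^\dagger}(v,K^*p^\dagger)=J^*(v)-J^*(K^*p^\dagger)-\langle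 u^\dagger,v-K^*p^\dagger\rangle$. *)

theory Defs
  imports "HOL-Analysis.Analysis"
begin

definition effective_domain :: "('a \<Rightarrow> ereal) \<Rightarrow> 'a set" where
  "effective_domain F = {u. F u < \<infinity>}"

definition proper_functional :: "('a \<Rightarrow> ereal) \<Rightarrow> bool" where
  "proper_functional F \<longleftrightarrow> (\<forall>u. F u \<noteq> - \<infinity>) \<and> effective_domain F \<noteq> {}"

(* Only meaningful for F without the value -\<infinity>. In ereal, 0 * \<infinity> = 0, so the
   end points a = 0 and b = 0 impose no condition. *)
definition convex_functional :: "('a::real_vector \<Rightarrow> ereal) \<Rightarrow> bool" where
  "convex_functional F \<longleftrightarrow>
     (\<forall>x y. \<forall>a\<ge>0. \<forall>b\<ge>0. a + b = 1 \<longrightarrow>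
        F (a *\<^sub>R x + b *\<^sub>R y) \<le> ereal a * F x + ereal b * F y)"

definition lower_semicontinuous :: "('a::topological_space \<Rightarrow> ereal) \<Rightarrow> bool" where
  "lower_semicontinuous F \<longleftrightarrow> (\<forall>u. F u \<le> Liminf (at u) F)"

definition weakly_converges_to :: "(nat \<Rightarrow> 'a::real_normed_vector) \<Rightarrow> 'a \<Rightarrow> bool" where
  "weakly_converges_to X x \<longleftrightarrow>
     (\<forall>f :: 'a \<Rightarrow> real. bounded_linear f \<longrightarrow> (\<lambda>n. f (X n)) \<longlonglongrightarrow> f x)"

definition weakly_seq_precompact :: "'a::real_normed_vector set \<Rightarrow> bool" where
  "weakly_seq_precompact S \<longleftrightarrow>
     (\<forall>X :: nat \<Rightarrow> 'a. (\<forall>n. X n \<in> S) \<longrightarrow>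
        (\<exists>r x. strict_mono r \<and> weakly_converges_to (X \<circ> r) x))"

definition subdifferential :: "('a::real_inner \<Rightarrow> ereal) \<Rightarrow> 'a \<Rightarrow> 'a set" where
  "subdifferential F u =
     {\<xi>. \<bar>F u\<bar> \<noteq> \<infinity> \<and> (\<forall>v. F u + ereal (\<xi> \<bullet> (v - u)) \<le> F v)}"

definition fenchel_conjugate :: "('a::real_inner \<Rightarrow> ereal) \<Rightarrow> 'a \<Rightarrow> ereal" where
  "fenchel_conjugate F v = (SUP u. ereal (v \<bullet> u) - F u)"

(* bregman_distance F \<xi> v u is D_F^\<xi>(v,u), used for \<xi> \<in> subdifferential F u; then F u is
   finite and no difference \<infinity> - \<infinity> arises. *)
definition bregman_distance :: "('a::real_inner \<Rightarrow> ereal) \<Rightarrow> 'a \<Rightarrow> 'a \<Rightarrow> 'a \<Rightarrow> ereal" where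
  "bregman_distance F \<xi> v u = F v - F u - ereal (\<xi> \<bullet> (v - u))"

definition attainable ::
    "('a \<Rightarrow> 'b) \<Rightarrow> ('a \<Rightarrow> ereal) \<Rightarrow> 'b \<Rightarrow> bool" where
  "attainable K J g \<longleftrightarrow> (\<exists>u \<in> effective_domain J. K u = g)"

definition J_minimizing_solution ::
    "('a \<Rightarrow> 'b) \<Rightarrow> ('a \<Rightarrow> ereal) \<Rightarrow> 'b \<Rightarrow> 'a \<Rightarrow> bool" where
  "J_minimizing_solution K J g u \<longleftrightarrow> is_arg_min J (\<lambda>v. K v = g) u"

(* \<tau> n and u n are meaningful for n \<ge> 1 only; p 0 is the starting element. *)
definition augmented_lagrangian_iterates ::
    "('a \<Rightarrow> 'b::real_inner) \<Rightarrow> ('a \<Rightarrow> ereal) \<Rightarrow> (nat \<Rightarrow> real) \<Rightarrow> 'b \<Rightarrow>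
     (nat \<Rightarrow> 'a) \<Rightarrow> (nat \<Rightarrow> 'b) \<Rightarrow> bool" where
  "augmented_lagrangian_iterates K J \<tau> g u p \<longleftrightarrow>
     (\<forall>n\<ge>1.
        is_arg_min
          (\<lambda>v. ereal (\<tau> n / 2 * (norm (K v - g))\<^sup>2) + J v - ereal (p (n - 1) \<bullet> (K v - g)))
          (\<lambda>_. True) (u n) \<and>
        p n = p (n - 1) + \<tau> n *\<^sub>R (g - K (u n)))"

end

theory Submission
  imports Defs
begin

text \<open>
  The optimality condition of the \<open>n\<close>-th subproblem says \<open>K\<^sup>* p\<^sub>n \<in> \<partial>J(u\<^sub>n)\<close>, so
  \<open>r\<^sub>n = K u\<^sub>n - g\<^sup>\<delta>\<close> is a subgradient at \<open>p\<^sub>n\<close> of the dual functional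
  \<open>\<psi>(q) = J\<^sup>*(K\<^sup>* q) - \<langle>q, g\<^sup>\<delta>\<rangle>\<close> and \<open>p\<^sub>n = p\<^sub>n\<^sub>-\<^sub>1 - \<tau>\<^sub>n r\<^sub>n\<close>: the method is the proximal point
  method for \<open>\<psi>\<close>. Since \<open>\<parallel>r\<^sub>n\<parallel>\<close> decreases, the energy
  \<open>t\<^sub>n (\<psi>(p\<^sub>n) - \<psi>(p\<^sup>\<dagger>)) + \<parallel>p\<^sub>n - p\<^sup>\<dagger>\<parallel>\<^sup>2 / 2 + t\<^sub>n\<^sup>2 \<parallel>r\<^sub>n\<parallel>\<^sup>2 / 2\<close> never exceeds \<open>\<parallel>p\<^sub>0 - p\<^sup>\<dagger>\<parallel>\<^sup>2 / 2\<close>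
  (Gueler's estimate). Replacing \<open>g\<^sup>\<delta>\<close> by \<open>g\<close> costs \<open>\<langle>p\<^sub>n - p\<^sup>\<dagger>, g\<^sup>\<delta> - g\<rangle>\<close>, which Young's
  inequality with parameter \<open>\<gamma> t\<^sub>n\<close> absorbs.
\<close>

subsection \<open>Riesz representation and adjoints\<close>

text \<open>Divide by \<open>s\<close> and let \<open>s\<close> tend to 0 from the right. This turns
  minimality along a segment into a first-order condition.\<close>

lemma nonneg_of_quadratic_nonneg:
  fixes a b :: real
  assumes "\<And>s. 0 < s \<Longrightarrow> s \<le> 1 \<Longrightarrow> 0 \<le> s * a + s\<^sup>2 * b"
  shows "0 \<le> a"
proof (rule tendsto_lowerbound)
  show "((\<lambda>s. a + s * b) \<longlongrightarrow> a) (at_right 0)"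
    by (auto intro!: tendsto_eq_intros)
  have "0 \<le> a + s * b" if "0 < s" "s \<le> 1" for s
  proof -
    have "0 \<le> s * (a + s * b)"
      using assms[OF that] by (simp add: algebra_simps power2_eq_square)
    with that(1) show ?thesis
      by (simp add: zero_le_mult_iff)
  qed
  moreover have "\<forall>\<^sub>F s in at_right (0::real). 0 < s \<and> s \<le> 1"
    by (auto simp: eventually_at_right_field intro!: exI[of _ 1])
  ultimately show "\<forall>\<^sub>F s in at_right 0. 0 \<le> a + s * b"
    by (auto elim: eventually_mono)
qed simp

text \<open>The representer is the minimizer of the strictly convex \<open>Q\<close>. Minimizing
  sequences are Cauchy, completeness supplies the limit, and stationarity there is the
  claim.\<close>

lemma riesz_representation:
  fixes f :: "'a::{real_inner,complete_space} \<Rightarrow> real"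
  assumes "bounded_linear f"
  shows "\<exists>z. \<forall>x. f x = z \<bullet> x"
proof -
  interpret f: bounded_linear f by fact
  define Q where "Q x = (norm x)\<^sup>2 / 2 - f x" for x
  obtain M where M: "\<And>x. norm (f x) \<le> norm x * M"
    using f.bounded by blast
  have Q_lower: "- (M\<^sup>2 / 2) \<le> Q x" for x
  proof -
    have "f x \<le> norm x * M"
      using M[of x] by simp
    moreover have "0 \<le> (norm x - M)\<^sup>2" by simp
    ultimately show ?thesis
      by (simp add: Q_def power2_diff)
  qed
  define m where "m = (INF x. Q x)"
  have bdd: "bdd_below (range Q)"
    using Q_lower by (auto intro!: bdd_belowI[of _ "- (M\<^sup>2 / 2)"])
  have m_le: "m \<le> Q x" for x
    unfolding m_def using bdd by (rule cINF_lower) simp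
  define \<epsilon> where "\<epsilon> n = inverse (real (Suc n))" for n
  have "\<exists>x. Q x < m + \<epsilon> n" for n
  proof -
    have "(INF x. Q x) < m + \<epsilon> n"
      by (simp add: m_def \<epsilon>_def)
    then show ?thesis
      using bdd by (subst (asm) cINF_less_iff) auto
  qed
  then obtain X where X: "\<And>n. Q (X n) < m + \<epsilon> n"
    by metis
  \<comment> \<open>Parallelogram law: the linear part \<open>f\<close> cancels, so near-minimal
    values of \<open>Q\<close> force nearby points.\<close>
  have midpoint: "(norm (x - y))\<^sup>2 = 4 * (Q x + Q y - 2 * Q ((1/2) *\<^sub>R (x + y)))" for x y
    by (simp add: Q_def f.add f.scaleR power2_norm_eq_inner inner_add inner_diff
        inner_commute algebra_simps)
  have close: "(norm (X i - X j))\<^sup>2 \<le> 4 * (\<epsilon> i + \<epsilon> j)" for i j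
  proof -
    have "Q (X i) + Q (X j) - 2 * Q ((1/2) *\<^sub>R (X i + X j))
        \<le> \<epsilon> i + \<epsilon> j"
      using X[of i] X[of j] m_le[of "(1/2) *\<^sub>R (X i + X j)"] by linarith
    then show ?thesis
      unfolding midpoint by simp
  qed
  have "Cauchy X"
  proof (rule metric_CauchyI)
    fix e :: real
    assume "0 < e"
    then have "0 < e\<^sup>2 / 8" by simp
    then obtain N where N: "\<epsilon> N < e\<^sup>2 / 8"
      using reals_Archimedean unfolding \<epsilon>_def by blast
    have "dist (X i) (X j) < e" if "i \<ge> N" "j \<ge> N" for i j
    proof -
      have "\<epsilon> i \<le> \<epsilon> N"
        and "\<epsilon> j \<le> \<epsilon> N"
        using that by (auto simp: \<epsilon>_def intro!: le_imp_inverse_le)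
      with N have "4 * (\<epsilon> i + \<epsilon> j) < e\<^sup>2"
        by simp
      with close[of i j] have "(norm (X i - X j))\<^sup>2 < e\<^sup>2"
        by (rule le_less_trans)
      with \<open>0 < e\<close> show ?thesis
        by (simp add: dist_norm power2_less_imp_less)
    qed
    then show "\<exists>N. \<forall>i\<ge>N. \<forall>j\<ge>N. dist (X i) (X j) < e"
      by blast
  qed
  then obtain z where z: "X \<longlonglongrightarrow> z"
    using Cauchy_convergent convergent_def by blast
  have "(\<lambda>n. Q (X n)) \<longlonglongrightarrow> Q z"
    unfolding Q_def by (intro tendsto_intros f.tendsto z) simp
  moreover have "(\<lambda>n. m + \<epsilon> n) \<longlonglongrightarrow> m + 0"
    unfolding \<epsilon>_def by (intro tendsto_intros LIMSEQ_inverse_real_of_nat)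
  ultimately have Qz: "Q z \<le> m"
    using X by (intro LIMSEQ_le[of "\<lambda>n. Q (X n)" _ "\<lambda>n. m + \<epsilon> n"])
      (auto intro: less_imp_le)
  have ge: "0 \<le> z \<bullet> h - f h" for h
  proof (rule nonneg_of_quadratic_nonneg)
    fix s :: real
    have "Q z \<le> Q (z + s *\<^sub>R h)"
      using Qz m_le order_trans by blast
    then show "0 \<le> s * (z \<bullet> h - f h) + s\<^sup>2 * ((norm h)\<^sup>2 / 2)"
      unfolding Q_def power2_norm_eq_inner
      by (simp add: f.add f.scaleR inner_add inner_commute algebra_simps power2_eq_square)
  qed
  \<comment> \<open>Using \<open>ge\<close> at \<open>h\<close> and at \<open>- h\<close> upgrades
    the inequality to equality.\<close>
  have "f h = z \<bullet> h" for h
    using ge[of h] ge[of "- h"] f.diff[of 0 h] by (simp add: f.zero)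
  then show ?thesis by blast
qed

text \<open>\<open>adjoint\<close> is defined by choice, so its characteristic identity needs an
  existence proof; Riesz gives one for each \<open>y\<close>.\<close>

lemma adjoint_bounded_linear:
  fixes K :: "'a::{real_inner,complete_space} \<Rightarrow> 'b::real_inner"
  assumes "bounded_linear K"
  shows "adjoint K y \<bullet> x = y \<bullet> K x"
proof -
  have "\<exists>z. \<forall>x. y \<bullet> K x = z \<bullet> x" for y
    by (intro riesz_representation bounded_linear_inner_right_comp assms)
  then obtain A where "\<And>y x. y \<bullet> K x = A y \<bullet> x"
    by metis
  then have "\<exists>A. \<forall>x y. K x \<bullet> y = x \<bullet> A y"
    by (metis inner_commute)
  then have "\<forall>x y. K x \<bullet> y = x \<bullet> adjoint K y"
    unfolding adjoint_def by (rule someI_ex)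
  then show ?thesis
    by (metis inner_commute)
qed

subsection \<open>Subgradients\<close>

lemma subdifferential_real:
  assumes "\<xi> \<in> subdifferential F x"
  shows "F x = ereal (real_of_ereal (F x))"
  using assms by (auto simp: subdifferential_def ereal_real)

text \<open>Membership in \<open>subdifferential\<close> includes finiteness of the value. The
  element \<open>\<eta>\<close> serves to make \<open>F y\<close> finite, which allows real
  arithmetic.\<close>

lemma subdifferential_real_le:
  assumes "\<xi> \<in> subdifferential F x" and "\<eta> \<in> subdifferential F y"
  shows "real_of_ereal (F x) + \<xi> \<bullet> (y - x) \<le> real_of_ereal (F y)"
proof -
  have "F x + ereal (\<xi> \<bullet> (y - x)) \<le> F y"
    using assms(1) by (auto simp: subdifferential_def)
  then show ?thesis
    by (metis subdifferential_real assms ereal_less_eq(3) plus_ereal.simps(1))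
qed

text \<open>Equality case of Fenchel-Young: the subgradient inequality says that the supremum
  defining the conjugate is attained at \<open>x\<close>.\<close>

lemma fenchel_conjugate_subgradient:
  assumes "\<xi> \<in> subdifferential F x"
  shows "fenchel_conjugate F \<xi> = ereal (\<xi> \<bullet> x - real_of_ereal (F x))"
  unfolding fenchel_conjugate_def
proof (rule antisym)
  have Fx: "F x = ereal (real_of_ereal (F x))"
    by (rule subdifferential_real) fact
  show "(SUP u. ereal (\<xi> \<bullet> u) - F u) \<le> ereal (\<xi> \<bullet> x - real_of_ereal (F x))"
  proof (rule SUP_least)
    fix v
    have "ereal (real_of_ereal (F x) + \<xi> \<bullet> (v - x)) \<le> F v"
      using assms Fx by (auto simp: subdifferential_def)
    then show "ereal (\<xi> \<bullet> v) - F v \<le> ereal (\<xi> \<bullet> x - real_of_ereal (F x))"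
      by (cases "F v") (auto simp: inner_diff_right)
  qed
  have "ereal (\<xi> \<bullet> x) - F x \<le> (SUP u. ereal (\<xi> \<bullet> u) - F u)"
    by (rule SUP_upper) simp
  then show "ereal (\<xi> \<bullet> x - real_of_ereal (F x)) \<le> (SUP u. ereal (\<xi> \<bullet> u) - F u)"
    by (subst (asm) Fx) simp
qed

text \<open>Compare \<open>x\<close> with points of the segment towards \<open>v\<close>: convexity
  bounds \<open>J\<close> by its chord and the penalty is quadratic in the step \<open>s\<close>, so
  the coefficient of \<open>s\<close> must be nonnegative.\<close>

lemma subdifferential_augmented_lagrangian_minimizer:
  fixes K :: "'a::{real_inner,complete_space} \<Rightarrow> 'b::real_inner"
  assumes K: "bounded_linear K"
    and conv: "convex_functional J"
    and proper: "proper_functional J"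
    and argmin: "is_arg_min
      (\<lambda>v. ereal (\<tau> / 2 * (norm (K v - g))\<^sup>2) + J v - ereal (w \<bullet> (K v - g))) (\<lambda>_. True) x"
  shows "adjoint K (w + \<tau> *\<^sub>R (g - K x)) \<in> subdifferential J x"
proof -
  interpret K: bounded_linear K by fact
  have min: "ereal (\<tau> / 2 * (norm (K x - g))\<^sup>2) + J x - ereal (w \<bullet> (K x - g))
      \<le> ereal (\<tau> / 2 * (norm (K v - g))\<^sup>2) + J v - ereal (w \<bullet> (K v - g))" for v
    using argmin by (auto simp: is_arg_min_linorder)
  have not_minf: "J v \<noteq> - \<infinity>" for v
    using proper by (auto simp: proper_functional_def)
  \<comment> \<open>Minimality against a point of finite value excludes
    \<open>J x = \<infinity>\<close>.\<close>
  obtain v0 where "J v0 < \<infinity>"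
    using proper by (auto simp: proper_functional_def effective_domain_def)
  with min[of v0] not_minf[of x] obtain jx where jx: "J x = ereal jx"
    by (cases "J x"; cases "J v0") auto
  have "J x + ereal (adjoint K (w + \<tau> *\<^sub>R (g - K x)) \<bullet> (v - x)) \<le> J v" for v
  proof (cases "J v")
    case (real jv)
    define d where "d = K v - K x"
    define a where "a = K x - g"
    have "0 \<le> jv - jx - (w - \<tau> *\<^sub>R a) \<bullet> d"
    proof (rule nonneg_of_quadratic_nonneg)
      fix s :: real
      assume s: "0 < s" "s \<le> 1"
      let ?y = "(1 - s) *\<^sub>R x + s *\<^sub>R v"
      have "J ?y \<le> ereal (1 - s) * J x + ereal s * J v"
        using conv s unfolding convex_functional_def by simp
      then have "J ?y \<le> ereal ((1 - s) * jx + s * jv)"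
        by (simp add: jx real)
      then obtain jy where jy: "J ?y = ereal jy" "jy \<le> (1 - s) * jx + s * jv"
        using not_minf[of ?y] by (cases "J ?y") auto
      have Ky: "K ?y - g = a + s *\<^sub>R d"
        unfolding K.add K.scaleR by (simp add: a_def d_def algebra_simps)
      have "\<tau> / 2 * (norm a)\<^sup>2 + jx - w \<bullet> a
          \<le> \<tau> / 2 * (norm (a + s *\<^sub>R d))\<^sup>2 + jy - w \<bullet> (a + s *\<^sub>R d)"
        using min[of ?y] unfolding Ky jy(1) jx by (simp add: a_def)
      moreover have "\<tau> / 2 * (norm (a + s *\<^sub>R d))\<^sup>2
          = \<tau> / 2 * (norm a)\<^sup>2 + s * (\<tau> * (a \<bullet> d)) + s\<^sup>2 * (\<tau> / 2 * (norm d)\<^sup>2)"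
        unfolding power2_norm_eq_inner
        by (simp add: inner_add inner_commute algebra_simps power2_eq_square)
      ultimately show "0 \<le> s * (jv - jx - (w - \<tau> *\<^sub>R a) \<bullet> d) + s\<^sup>2 * (\<tau> / 2 * (norm d)\<^sup>2)"
        using jy(2) by (simp add: inner_add inner_diff algebra_simps add_divide_distrib)
    qed
    moreover have "adjoint K (w + \<tau> *\<^sub>R (g - K x)) \<bullet> (v - x) = (w - \<tau> *\<^sub>R a) \<bullet> d"
      by (simp add: adjoint_bounded_linear[OF K] K.diff a_def d_def algebra_simps)
    ultimately show ?thesis
      by (simp add: jx real)
  qed (use not_minf in auto)
  then show ?thesis
    by (simp add: subdifferential_def jx)
qed

subsection \<open>The proximal point estimate\<close>

lemma two_inner_norm:
  fixes a b :: "'a::real_inner"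
  shows "2 * (a \<bullet> b) = (norm (a + b))\<^sup>2 - (norm b)\<^sup>2 - (norm a)\<^sup>2"
  by (simp add: power2_norm_eq_inner inner_add inner_commute)

text \<open>The dual functional enters only through its values \<open>\<psi> k\<close> at
  \<open>p k\<close> and \<open>\<psi>q\<close> at \<open>q\<close>, with \<open>r k\<close> as
  subgradient at \<open>p k\<close>.\<close>

lemma proximal_point_estimate:
  fixes p r :: "nat \<Rightarrow> 'a::real_inner" and \<tau> \<psi> :: "nat \<Rightarrow> real"
  assumes step: "\<And>k. k \<ge> 1 \<Longrightarrow> p k = p (k - 1) - \<tau> k *\<^sub>R r k"
    and pos: "\<And>k. k \<ge> 1 \<Longrightarrow> \<tau> k > 0"
    and subgrad: "\<And>k l. k \<ge> 1 \<Longrightarrow> l \<ge> 1 \<Longrightarrow> \<psi> k + r k \<bullet> (p l - p k) \<le> \<psi> l"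
    and subgrad_q: "\<And>k. k \<ge> 1 \<Longrightarrow> \<psi> k + r k \<bullet> (q - p k) \<le> \<psi>q"
    and "n \<ge> 1"
  shows "(\<Sum>k=1..n. \<tau> k) * (\<psi> n - \<psi>q) + (norm (p n - q))\<^sup>2 / 2
      + (\<Sum>k=1..n. \<tau> k)\<^sup>2 / 2 * (norm (r n))\<^sup>2 \<le> (norm (p 0 - q))\<^sup>2 / 2"
  using \<open>n \<ge> 1\<close>
proof (induction n rule: dec_induct)
  \<comment> \<open>The classical proximal inequality. At \<open>k = 1\<close> it is the base case;
    at \<open>k = Suc n\<close> it is the share of the new step in the induction.\<close>
  have one_step: "\<tau> k * (\<psi> k - \<psi>q) + (norm (p k - q))\<^sup>2 / 2 + (\<tau> k)\<^sup>2 / 2 * (norm (r k))\<^sup>2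
      \<le> (norm (p (k - 1) - q))\<^sup>2 / 2" if "k \<ge> 1" for k
  proof -
    have "\<tau> k * (\<psi> k - \<psi>q) \<le> \<tau> k * (r k \<bullet> (p k - q))"
      using subgrad_q[OF that] pos[OF that] by (intro mult_left_mono) (auto simp: inner_diff_right)
    moreover have "2 * (\<tau> k * (r k \<bullet> (p k - q)))
        = (norm (p (k - 1) - q))\<^sup>2 - (norm (p k - q))\<^sup>2 - (\<tau> k)\<^sup>2 * (norm (r k))\<^sup>2"
    proof -
      have eq: "\<tau> k *\<^sub>R r k + (p k - q) = p (k - 1) - q"
        using step[OF that] by simp
      show ?thesis
        using two_inner_norm[of "\<tau> k *\<^sub>R r k" "p k - q", unfolded eq]
        by (simp add: power_mult_distrib)
    qed
    ultimately show ?thesis by linarith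
  qed
  {
    case base
    show ?case using one_step[of 1] by simp
  next
    case (step n)
    define T where "T = (\<Sum>k=1..n. \<tau> k)"
    define \<sigma> where "\<sigma> = \<tau> (Suc n)"
    have T: "T \<ge> 0"
      unfolding T_def using pos by (intro sum_nonneg) (auto intro: less_imp_le)
    have \<sigma>: "\<sigma> > 0"
      unfolding \<sigma>_def using pos by simp
    have p_Suc: "p n - p (Suc n) = \<sigma> *\<^sub>R r (Suc n)"
      using assms(1)[of "Suc n"] by (simp add: \<sigma>_def)
    have p_Suc': "p (Suc n) - p n = - (\<sigma> *\<^sub>R r (Suc n))"
      using p_Suc by (metis minus_diff_eq)
    \<comment> \<open>The subgradient inequality between \<open>p n\<close> and
      \<open>p (Suc n)\<close>, taken in both directions, shows that the norm of \<open>r\<close>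
      does not increase.\<close>
    have descent: "\<psi> (Suc n) + \<sigma> * (norm (r (Suc n)))\<^sup>2 \<le> \<psi> n"
      using subgrad[of "Suc n" n] step(1) by (simp add: p_Suc power2_norm_eq_inner)
    have "\<psi> n - \<sigma> * (r n \<bullet> r (Suc n)) \<le> \<psi> (Suc n)"
      using subgrad[of n "Suc n"] step(1) by (simp add: p_Suc')
    with descent have "\<sigma> * (norm (r (Suc n)))\<^sup>2 \<le> \<sigma> * (r n \<bullet> r (Suc n))"
      by linarith
    then have "(norm (r (Suc n)))\<^sup>2 \<le> r n \<bullet> r (Suc n)"
      using \<sigma> by simp
    moreover have "2 * (r n \<bullet> r (Suc n)) \<le> (norm (r n))\<^sup>2 + (norm (r (Suc n)))\<^sup>2"
      using zero_le_power2[of "norm (r n - r (Suc n))"]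
      by (simp add: power2_norm_eq_inner inner_diff inner_commute)
    ultimately have "(norm (r (Suc n)))\<^sup>2 \<le> (norm (r n))\<^sup>2"
      by linarith
    \<comment> \<open>Expanding half the square of \<open>T + \<sigma>\<close> gives three terms:
      the first is covered by this monotonicity and the induction hypothesis, the mixed term
      \<open>T * \<sigma>\<close> by \<open>T\<close> times \<open>descent\<close>, the last by
      \<open>one_step\<close>.\<close>
    then have "T\<^sup>2 / 2 * (norm (r (Suc n)))\<^sup>2 \<le> T\<^sup>2 / 2 * (norm (r n))\<^sup>2"
      by (intro mult_left_mono) auto
    moreover have "T * (\<psi> (Suc n) + \<sigma> * (norm (r (Suc n)))\<^sup>2) \<le> T * \<psi> n"
      using descent T by (intro mult_left_mono)
    moreover have "\<sigma> * (\<psi> (Suc n) - \<psi>q) + (norm (p (Suc n) - q))\<^sup>2 / 2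
        + \<sigma>\<^sup>2 / 2 * (norm (r (Suc n)))\<^sup>2 \<le> (norm (p n - q))\<^sup>2 / 2"
      using one_step[of "Suc n"] by (simp add: \<sigma>_def)
    moreover have "T * (\<psi> n - \<psi>q) + (norm (p n - q))\<^sup>2 / 2 + T\<^sup>2 / 2 * (norm (r n))\<^sup>2
        \<le> (norm (p 0 - q))\<^sup>2 / 2"
      using step.IH by (simp add: T_def)
    moreover have "(\<Sum>k=1..Suc n. \<tau> k) = T + \<sigma>"
      by (simp add: T_def \<sigma>_def)
    ultimately show ?case
      by (simp add: algebra_simps power2_sum add_divide_distrib)
  }
qed

subsection \<open>The error estimate\<close>

theorem theorem3p4:
  fixes K :: "'a::{real_inner,complete_space} \<Rightarrow> 'b::{real_inner,complete_space}"
    and J :: "'a \<Rightarrow> ereal"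
    and g g\<delta> p0 p_dag :: 'b
    and u_dag :: 'a
    and \<tau> t :: "nat \<Rightarrow> real"
    and u :: "nat \<Rightarrow> 'a"
    and p :: "nat \<Rightarrow> 'b"
    and \<delta> \<gamma> :: real
    and n :: nat
  assumes "separable_space (euclidean :: 'a topology)"
    and "separable_space (euclidean :: 'b topology)"
    and "bounded_linear K"
    and "convex_functional J"
    and "lower_semicontinuous J"
    and "proper_functional J"
    and "\<And>c::real. weakly_seq_precompact {v. ereal ((norm (K v))\<^sup>2) + J v \<le> ereal c}"
    and "attainable K J g"
    and "\<And>k. k \<ge> 1 \<Longrightarrow> \<tau> k > 0"
    and "bdd_above (\<tau> ` {1..})"
    and "\<And>m. t m = (\<Sum>k=1..m. \<tau> k)"
    and "filterlim t at_top sequentially"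
    and "\<delta> \<ge> 0"
    and "norm (g\<delta> - g) \<le> \<delta>"
    and "augmented_lagrangian_iterates K J \<tau> g\<delta> u p"
    and "p 0 = p0"
    and "J_minimizing_solution K J g u_dag"
    and "adjoint K p_dag \<in> subdifferential J u_dag"
    and "\<gamma> > 0"
    and "n \<ge> 1"
  shows "bregman_distance (fenchel_conjugate J) u_dag (adjoint K (p n)) (adjoint K p_dag)
           + ereal (t n / 4 * (norm (K (u n) - g))\<^sup>2)
           + ereal ((\<gamma> - 1) / (2 * \<gamma> * t n) * (norm (p n - p_dag))\<^sup>2)
         \<le> ereal ((norm (p_dag - p0))\<^sup>2 / (2 * t n) + (1 + \<gamma>) * t n / 2 * \<delta>\<^sup>2)"
proof -
  interpret K: bounded_linear K by fact
  note adj = adjoint_bounded_linear[OF \<open>bounded_linear K\<close>]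
  have adj': "x \<bullet> adjoint K y = y \<bullet> K x" for x y
    by (metis adj inner_commute)
  note iter = \<open>augmented_lagrangian_iterates K J \<tau> g\<delta> u p\<close>[unfolded augmented_lagrangian_iterates_def]
  have p_step: "p k = p (k - 1) + \<tau> k *\<^sub>R (g\<delta> - K (u k))" if "k \<ge> 1" for k
    using iter that by blast
  have opt: "adjoint K (p k) \<in> subdifferential J (u k)" if "k \<ge> 1" for k
    using subdifferential_augmented_lagrangian_minimizer[OF assms(3,4,6)] iter that
    unfolding p_step[OF that] by blast
  note opt_dag = \<open>adjoint K p_dag \<in> subdifferential J u_dag\<close>
  have Kdag: "K u_dag = g"
    using \<open>J_minimizing_solution K J g u_dag\<close> by (simp add: J_minimizing_solution_def is_arg_min_def)
  define j where "j k = real_of_ereal (J (u k))" for k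
  define jd where "jd = real_of_ereal (J u_dag)"
  define r where "r k = K (u k) - g\<delta>" for k
  \<comment> \<open>By the Fenchel-Young equality, \<open>\<psi> k\<close> and
    \<open>\<psi>d\<close> are the dual functional at \<open>p k\<close> and \<open>p_dag\<close>,
    written through primal quantities.\<close>
  define \<psi> where "\<psi> k = p k \<bullet> r k - j k" for k
  define \<psi>d where "\<psi>d = p_dag \<bullet> (g - g\<delta>) - jd"
  \<comment> \<open>Roles swap under duality: after cancellation this is the subgradient inequality
    of \<open>J\<close> at \<open>u l\<close>, tested at \<open>u k\<close>.\<close>
  have subgrad: "\<psi> k + r k \<bullet> (p l - p k) \<le> \<psi> l" if "k \<ge> 1" "l \<ge> 1" for k l
    using subdifferential_real_le[OF opt[OF that(2)] opt[OF that(1)]]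
    by (simp add: \<psi>_def r_def j_def adj adj' K.diff inner_diff inner_commute)
  have subgrad_dag: "\<psi> k + r k \<bullet> (p_dag - p k) \<le> \<psi>d" if "k \<ge> 1" for k
    using subdifferential_real_le[OF opt_dag opt[OF that]]
    by (simp add: \<psi>_def \<psi>d_def r_def j_def jd_def adj adj' K.diff Kdag inner_diff inner_commute)
  have est: "t n * (\<psi> n - \<psi>d) + (norm (p n - p_dag))\<^sup>2 / 2 + (t n)\<^sup>2 / 2 * (norm (r n))\<^sup>2
      \<le> (norm (p_dag - p0))\<^sup>2 / 2"
    unfolding assms(11) norm_minus_commute[of p_dag] \<open>p 0 = p0\<close>[symmetric]
  proof (rule proximal_point_estimate)
    show "p k = p (k - 1) - \<tau> k *\<^sub>R r k" if "k \<ge> 1" for k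
      using p_step[OF that] by (simp add: r_def algebra_simps)
  qed (use assms(9) subgrad subgrad_dag \<open>n \<ge> 1\<close> in auto)
  have tn: "t n > 0"
    unfolding assms(11) using \<open>n \<ge> 1\<close> assms(9) by (intro sum_pos) auto
  define P where "P = norm (p n - p_dag)"
  \<comment> \<open>The values \<open>\<psi>\<close> pair with \<open>g\<delta>\<close>, whereas the
    linear term of the Bregman distance pairs with \<open>K u_dag = g\<close>; the last summand
    corrects the difference.\<close>
  define D where "D = \<psi> n - \<psi>d + (p n - p_dag) \<bullet> (g\<delta> - g)"
  have "bregman_distance (fenchel_conjugate J) u_dag (adjoint K (p n)) (adjoint K p_dag) = ereal D"
    unfolding bregman_distance_def fenchel_conjugate_subgradient[OF opt[OF \<open>n \<ge> 1\<close>]]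
      fenchel_conjugate_subgradient[OF opt_dag]
    by (simp add: inner_commute[of u_dag] inner_diff_left adj Kdag D_def \<psi>_def \<psi>d_def r_def j_def
        jd_def inner_diff_right)
  moreover have "D + t n / 4 * (norm (K (u n) - g))\<^sup>2 + (\<gamma> - 1) / (2 * \<gamma> * t n) * P\<^sup>2
      \<le> (norm (p_dag - p0))\<^sup>2 / (2 * t n) + (1 + \<gamma>) * t n / 2 * \<delta>\<^sup>2"
  proof -
    have energy: "\<psi> n - \<psi>d + P\<^sup>2 / (2 * t n) + t n / 2 * (norm (r n))\<^sup>2
        \<le> (norm (p_dag - p0))\<^sup>2 / (2 * t n)"
      using divide_right_mono[OF est less_imp_le[OF tn]] tn
      by (simp add: P_def add_divide_distrib power2_eq_square mult_ac)
    have "(p n - p_dag) \<bullet> (g\<delta> - g) \<le> P * norm (g\<delta> - g)"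
      unfolding P_def by (rule norm_cauchy_schwarz)
    also have "\<dots> \<le> P * \<delta>"
      using \<open>norm (g\<delta> - g) \<le> \<delta>\<close> by (intro mult_left_mono) (auto simp: P_def)
    also have "\<dots> \<le> \<gamma> * t n / 2 * \<delta>\<^sup>2 + P\<^sup>2 / (2 * \<gamma> * t n)"
    proof -
      have "0 \<le> (P - \<gamma> * t n * \<delta>)\<^sup>2 / (2 * \<gamma> * t n)"
        using tn \<open>\<gamma> > 0\<close> by simp
      also have "\<dots> = \<gamma> * t n / 2 * \<delta>\<^sup>2 + P\<^sup>2 / (2 * \<gamma> * t n) - P * \<delta>"
        using tn \<open>\<gamma> > 0\<close> by (simp add: field_simps power2_eq_square)
      finally show ?thesis by simp
    qed
    finally have young: "(p n - p_dag) \<bullet> (g\<delta> - g) \<le> \<gamma> * t n / 2 * \<delta>\<^sup>2 + P\<^sup>2 / (2 * \<gamma> * t n)" .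
    \<comment> \<open>Passing from \<open>g\<delta>\<close> to \<open>g\<close> doubles the squared
      residual, hence the factor 1/4 in place of the 1/2 in \<open>energy\<close>; it also
      contributes the 1 in \<open>1 + \<gamma>\<close>.\<close>
    have "norm (K (u n) - g) \<le> norm (r n) + \<delta>"
      using norm_triangle_ineq[of "r n" "g\<delta> - g"] \<open>norm (g\<delta> - g) \<le> \<delta>\<close> by (simp add: r_def)
    then have "(norm (K (u n) - g))\<^sup>2 \<le> (norm (r n) + \<delta>)\<^sup>2"
      by (rule power_mono) simp
    also have "\<dots> \<le> 2 * (norm (r n))\<^sup>2 + 2 * \<delta>\<^sup>2"
      using zero_le_power2[of "norm (r n) - \<delta>"] by (simp add: power2_sum power2_diff)
    finally have "t n / 4 * (norm (K (u n) - g))\<^sup>2 \<le> t n / 4 * (2 * (norm (r n))\<^sup>2 + 2 * \<delta>\<^sup>2)"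
      using tn by (intro mult_left_mono) auto
    then have residual: "t n / 4 * (norm (K (u n) - g))\<^sup>2
        \<le> t n / 2 * (norm (r n))\<^sup>2 + t n / 2 * \<delta>\<^sup>2"
      by (simp add: algebra_simps)
    \<comment> \<open>What remains of the \<open>P\<^sup>2\<close> term of \<open>energy\<close>
      once Young's inequality has consumed its part.\<close>
    have "(\<gamma> - 1) / (2 * \<gamma> * t n) * P\<^sup>2 = P\<^sup>2 / (2 * t n) - P\<^sup>2 / (2 * \<gamma> * t n)"
      using tn \<open>\<gamma> > 0\<close> by (simp add: field_simps)
    moreover have "(1 + \<gamma>) * t n / 2 * \<delta>\<^sup>2 = t n / 2 * \<delta>\<^sup>2 + \<gamma> * t n / 2 * \<delta>\<^sup>2"
      by (simp add: field_simps)
    ultimately show ?thesis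
      using energy young residual unfolding D_def by linarith
  qed
  ultimately show ?thesis
    by (simp add: P_def)
qed

end
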